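(* For each $k\in\{1,2,3,4\}$, all formulas $A_1,X_1,\dots,A_n,X_n,B,Y$: $(A_1,X_1),\dots,(A_n,X_n)\vdash_{OUT_k}(B,Y)$ if and only if $(A_1,X_1),\dots,(A_n,X_n)\vdash_{OUT_k^+}(B,Y)$ and $X_1,\dots,X_n\models Y$ in classical logic.
   Context: Formulas are classical propositional formulas built with $\top,\bot,\neg,\wedge,\vee,\to$; $\models$ denotes classical semantic entailment. An I/O pair is an ordered pair $(A,X)$ of formulas. Rules on pairs: (TOP) $(\top,\top)$ is derivable from no premises; (BOT) $(\bot,\bot)$ is derivable from no premises; (WO) from $(A,X)$ derive $(A,Y)$ whenever $X\models Y$; (SI) from $(A,X)$ derive $(B,X)$ whenever $B\models A$; (AND) from $(A,X_1)$ and $(A,X_2)$ derive $(A,X_1\wedge X_2)$; (OR) from $(A_1,X)$ and $(A_2,X)$ derive $(A_1\vee A_2,X)$; (CT) from $(A,X)$ and $(A\wedge X,Y)$ derive $(A,Y)$. The logics: $OUT_1$ = {TOP, WO, SI, AND}; $OUT_2$ = $OUT_1$ + OR; $OUT_3$ = $OUT_1$ + CT; $OUT_4$ = $OUT_1$ + OR + CT; $OUT_k^+$ = $OUT_k$ + BOT. $G\vdash_{L}(B,Y)$ means there is a finite tree with root $(B,Y)$, each leaf an element of $G$ or an axiom of $L$, and each non-leaf node obtained from its children by a rule of $L$. *)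

theory Defs
  imports Main
begin

datatype 'a form =
    Atom 'a
  | Top
  | Bot
  | Neg "'a form"
  | Conj "'a form" "'a form"
  | Disj "'a form" "'a form"
  | Imp "'a form" "'a form"

primrec eval_form :: "('a \<Rightarrow> bool) \<Rightarrow> 'a form \<Rightarrow> bool" where
  "eval_form v (Atom p) = v p"
| "eval_form v Top = True"
| "eval_form v Bot = False"
| "eval_form v (Neg A) = (\<not> eval_form v A)"
| "eval_form v (Conj A B) = (eval_form v A \<and> eval_form v B)"
| "eval_form v (Disj A B) = (eval_form v A \<or> eval_form v B)"
| "eval_form v (Imp A B) = (eval_form v A \<longrightarrow> eval_form v B)"

definition entails :: "'a form set \<Rightarrow> 'a form \<Rightarrow> bool" where
  "entails S A \<longleftrightarrow> (\<forall>v. (\<forall>C\<in>S. eval_form v C) \<longrightarrow> eval_form v A)"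

type_synonym 'a io_pair = "'a form \<times> 'a form"

datatype io_rule = TOP | BOT | WO | SI | AND | OR | CT

text \<open>
  A logic is the set of its rules. The inductive predicate \<open>derives L G\<close> holds of exactly the
  roots of finite derivation trees whose leaves are elements of \<open>G\<close> or axioms of \<open>L\<close> and
  whose other nodes are instances of rules of \<open>L\<close>.
\<close>

inductive derives :: "io_rule set \<Rightarrow> 'a io_pair set \<Rightarrow> 'a io_pair \<Rightarrow> bool"
  for L :: "io_rule set" and G :: "'a io_pair set" where
  premise: "p \<in> G \<Longrightarrow> derives L G p"
| top: "TOP \<in> L \<Longrightarrow> derives L G (Top, Top)"
| bot: "BOT \<in> L \<Longrightarrow> derives L G (Bot, Bot)"
| wo: "WO \<in> L \<Longrightarrow> derives L G (A, X) \<Longrightarrow> entails {X} Y \<Longrightarrow> derives L G (A, Y)"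
| si: "SI \<in> L \<Longrightarrow> derives L G (A, X) \<Longrightarrow> entails {B} A \<Longrightarrow> derives L G (B, X)"
| conj: "AND \<in> L \<Longrightarrow> derives L G (A, X1) \<Longrightarrow> derives L G (A, X2)
    \<Longrightarrow> derives L G (A, Conj X1 X2)"
| disj: "OR \<in> L \<Longrightarrow> derives L G (A1, X) \<Longrightarrow> derives L G (A2, X)
    \<Longrightarrow> derives L G (Disj A1 A2, X)"
| ct: "CT \<in> L \<Longrightarrow> derives L G (A, X) \<Longrightarrow> derives L G (Conj A X, Y)
    \<Longrightarrow> derives L G (A, Y)"

text \<open>Only the indices \<open>1, 2, 3, 4\<close> are meaningful; any other value is a dummy.\<close>

definition OUT :: "nat \<Rightarrow> io_rule set" where
  "OUT k =
    (if k = 1 then {TOP, WO, SI, AND}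
     else if k = 2 then {TOP, WO, SI, AND, OR}
     else if k = 3 then {TOP, WO, SI, AND, CT}
     else if k = 4 then {TOP, WO, SI, AND, OR, CT}
     else {})"

definition OUT_plus :: "nat \<Rightarrow> io_rule set" where
  "OUT_plus k = OUT k \<union> {BOT}"

end

theory Submission
  imports Defs
begin

text \<open>
  Let \<open>X\<close> be the conjunction of all heads of the given pairs. Every consequent derivable without
  BOT is entailed by \<open>X\<close>, since BOT is the only rule that can produce anything else.

  Conversely, the axiom \<open>(\<bottom>, \<bottom>)\<close> can be replaced by \<open>(\<bottom>, X)\<close>, which is derivable from the
  premises by SI and AND. Without OR, a derivation of \<open>(A, Y)\<close> with BOT thereby yields one of
  \<open>(A, Y)\<close> or of \<open>(A, X)\<close> without BOT. With OR it yields one of \<open>(A, Y \<or> X)\<close>. The only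
  difficult case is CT, where the middle formula is weakened from \<open>Z\<close> to \<open>Z \<or> X\<close>. There let
  \<open>M\<close> be the conjunction of the implications \<open>A\<^sub>i \<rightarrow> X\<^sub>i\<close>: as \<open>A \<and> M\<close> already entails \<open>Z\<close>, the
  second premise of CT applies to \<open>A \<and> M\<close> directly, while \<open>(\<not>M, X)\<close> is derivable, and OR merges
  the two cases. When \<open>X\<close> entails \<open>Y\<close>, all of these give \<open>(A, Y)\<close>.
\<close>

definition conj_list :: "'a form list \<Rightarrow> 'a form" where
  "conj_list Xs = foldr Conj Xs Top"

lemma conj_list_simps [simp]:
  "conj_list [] = Top"
  "conj_list (X # Xs) = Conj X (conj_list Xs)"
  by (simp_all add: conj_list_def)

lemma eval_conj_list [simp]: "eval_form v (conj_list Xs) \<longleftrightarrow> (\<forall>X\<in>set Xs. eval_form v X)"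
  by (induction Xs) auto

lemma entails_conj_list: "entails {conj_list Xs} Y \<longleftrightarrow> entails (set Xs) Y"
  by (auto simp: entails_def)

abbreviation materials :: "'a io_pair list \<Rightarrow> 'a form" where
  "materials ps \<equiv> conj_list (map (\<lambda>p. Imp (fst p) (snd p)) ps)"

lemma derives_mono:
  assumes "derives L G p" "L \<subseteq> L'"
  shows "derives L' G p"
  using assms by (induction rule: derives.induct) (auto intro: derives.intros)

lemma derives_entails_heads:
  assumes "derives L G p" "BOT \<notin> L"
  shows "entails (snd ` G) (snd p)"
  using assms by (induction rule: derives.induct) (auto simp: entails_def)

text \<open>Once each given pair is read as an implication, every rule is classically sound,
  \<open>BOT\<close> included.\<close>

lemma derives_material_sound:
  assumes "derives L (set ps) p"
  shows "entails {Conj (fst p) (materials ps)} (snd p)"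
  using assms by (induction rule: derives.induct) (auto simp: entails_def)

lemma derives_weaken:
  assumes "derives L G (A, X)" "{WO, SI} \<subseteq> L" "entails {B} A" "entails {X} Y"
  shows "derives L G (B, Y)"
  using assms by (blast intro: wo si)

lemma derives_conj_list:
  assumes "{TOP, WO, SI, AND} \<subseteq> L" "\<And>X. X \<in> set Xs \<Longrightarrow> derives L G (A, X)"
  shows "derives L G (A, conj_list Xs)"
  using assms(2)
proof (induction Xs)
  case Nil
  have "derives L G (Top, Top)" using assms(1) by (blast intro: top)
  then show ?case using assms(1) by (auto intro: si simp: entails_def)
next
  case (Cons X Xs)
  then show ?case using assms(1) by (auto intro: conj)
qed

lemma derives_Bot_heads:
  assumes L: "{TOP, WO, SI, AND} \<subseteq> L"
  shows "derives L (set ps) (Bot, conj_list (map snd ps))"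
proof (rule derives_conj_list[OF L])
  fix X assume "X \<in> set (map snd ps)"
  then obtain A where "(A, X) \<in> set ps" by auto
  then show "derives L (set ps) (Bot, X)"
    using L by (auto intro!: derives_weaken[OF premise] simp: entails_def)
qed

text \<open>The second alternative, once reached in a premise, survives each rule other than
  \<open>OR\<close>, whose two premises could fall under different alternatives.\<close>

lemma derives_BOT_dichotomy:
  assumes "derives (insert BOT L) (set ps) (A, Y)"
    and L: "{TOP, WO, SI, AND} \<subseteq> L" and "OR \<notin> L"
  shows "derives L (set ps) (A, Y) \<or> derives L (set ps) (A, conj_list (map snd ps))"
  using assms(1)
proof (induction "(A, Y)" arbitrary: A Y rule: derives.induct)
  case bot
  show ?case using derives_Bot_heads[OF L] by blast
next
  case (ct A X Y)
  then show ?case by (blast intro: derives.ct)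
qed (use assms(2,3) in \<open>blast intro: derives.intros\<close>)+

lemma derives_Neg_materials:
  assumes L: "{TOP, WO, SI, AND, OR, CT} \<subseteq> L" and "set qs \<subseteq> set ps"
  shows "derives L (set ps) (Neg (materials qs), conj_list (map snd ps))"
  using assms(2)
proof (induction qs)
  case Nil
  show ?case
    using L derives_Bot_heads[of L ps] by (auto elim!: derives_weaken simp: entails_def)
next
  case (Cons q qs)
  obtain A X where q: "q = (A, X)" by fastforce
  let ?N = "Neg (Imp A X)" and ?H = "conj_list (map snd ps)"
  have "derives L (set ps) (A, X)" using Cons.prems q by (auto intro: premise)
  then have "derives L (set ps) (?N, X)"
    using L by (auto elim!: derives_weaken simp: entails_def)
  \<comment> \<open>\<open>?N\<close> entails \<open>Neg X\<close>, so this body is contradictory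
    and \<open>SI\<close> reaches it from \<open>Bot\<close>.\<close>
  moreover have "derives L (set ps) (Conj ?N X, ?H)"
    using L derives_Bot_heads[of L ps] by (auto elim!: derives_weaken simp: entails_def)
  ultimately have "derives L (set ps) (?N, ?H)" using L by (blast intro: ct)
  then have "derives L (set ps) (Disj ?N (Neg (materials qs)), ?H)"
    using L Cons by (auto intro: disj)
  then show ?case
    using L q by (auto elim!: derives_weaken simp: entails_def)
qed

lemma derives_BOT_Disj_heads:
  assumes "derives (insert BOT L) (set ps) (A, Y)"
    and L: "{TOP, WO, SI, AND, OR} \<subseteq> L"
  shows "derives L (set ps) (A, Disj Y (conj_list (map snd ps)))" (is "?D (A, Disj Y ?H)")
  using assms(1)
proof (induction "(A, Y)" arbitrary: A Y rule: derives.induct)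
  case (premise A Y)
  then have "?D (A, Y)" by (rule derives.premise)
  then show ?case using L by (auto elim!: derives_weaken simp: entails_def)
next
  case top
  have "?D (Top, Top)" using L by (blast intro: derives.top)
  then show ?case using L by (auto elim!: derives_weaken simp: entails_def)
next
  case bot
  have "?D (Bot, ?H)" using L by (intro derives_Bot_heads) auto
  then show ?case using L by (auto elim!: derives_weaken simp: entails_def)
next
  case (wo A X Y)
  from wo(3) show ?case
    using L wo(4) by (auto elim!: derives_weaken simp: entails_def)
next
  case (si A X B)
  then show ?case using L by (blast intro: derives.si)
next
  case (conj A X1 X2)
  then have "?D (A, Conj (Disj X1 ?H) (Disj X2 ?H))" using L by (blast intro: derives.conj)
  then show ?case using L by (auto elim!: derives_weaken simp: entails_def)
next
  case (disj A1 X A2)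
  then show ?case using L by (blast intro: derives.disj)
next
  case (ct A Z Y)
  let ?M = "materials ps"
  \<comment> \<open>Soundness is applied to the original derivation of \<open>(A, Z)\<close>, not to
    its weakened form, so \<open>Z\<close> itself is obtained.\<close>
  have "entails {Conj A ?M} Z" using derives_material_sound[OF ct(2)] by simp
  with ct(5) have "?D (Conj A ?M, Disj Y ?H)"
    using L by (auto elim!: derives_weaken simp: entails_def)
  moreover have "?D (Neg ?M, ?H)" using L ct(1) by (intro derives_Neg_materials) auto
  then have "?D (Neg ?M, Disj Y ?H)"
    using L by (auto elim!: derives_weaken simp: entails_def)
  \<comment> \<open>\<open>A\<close> entails this disjunction by excluded middle on
    \<open>?M\<close>, so \<open>SI\<close> brings the body back to \<open>A\<close>.\<close>
  ultimately have "?D (Disj (Conj A ?M) (Neg ?M), Disj Y ?H)" using L by (blast intro: derives.disj)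
  then show ?case using L by (auto elim!: derives_weaken simp: entails_def)
qed

lemma derives_insert_BOT_iff:
  assumes L: "{TOP, WO, SI, AND} \<subseteq> L" and "BOT \<notin> L"
  shows "derives L (set ps) (B, Y) \<longleftrightarrow>
    derives (insert BOT L) (set ps) (B, Y) \<and> entails (set (map snd ps)) Y"
proof (intro iffI conjI; (elim conjE)?)
  assume D: "derives L (set ps) (B, Y)"
  show "derives (insert BOT L) (set ps) (B, Y)" using D by (rule derives_mono) blast
  show "entails (set (map snd ps)) Y" using derives_entails_heads[OF D assms(2)] by simp
next
  assume D: "derives (insert BOT L) (set ps) (B, Y)" and "entails (set (map snd ps)) Y"
  then have H: "entails {conj_list (map snd ps)} Y" by (simp only: entails_conj_list)
  show "derives L (set ps) (B, Y)"
  proof (cases "OR \<in> L")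
    case True
    then have "derives L (set ps) (B, Disj Y (conj_list (map snd ps)))"
      using derives_BOT_Disj_heads[OF D] L by auto
    then show ?thesis
      using L H by (auto elim!: derives_weaken simp: entails_def)
  next
    case False
    then show ?thesis using derives_BOT_dichotomy[OF D L] L H by (blast intro: wo)
  qed
qed

theorem theorem4:
  fixes k :: nat and ps :: "('a form \<times> 'a form) list" and B Y :: "'a form"
  assumes "k \<in> {1, 2, 3, 4}"
  shows "derives (OUT k) (set ps) (B, Y) \<longleftrightarrow>
    derives (OUT_plus k) (set ps) (B, Y) \<and> entails (set (map snd ps)) Y"
proof -
  have "{TOP, WO, SI, AND} \<subseteq> OUT k" "BOT \<notin> OUT k"
    using assms by (auto simp: OUT_def)
  then show ?thesis using derives_insert_BOT_iff[of "OUT k"] by (simp add: OUT_plus_def)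
qed

end
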